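(* Let $G$ be a $!$-graph and $b \in {!}(G)$. Then $\mathrm{Bound}_!(\mathrm{COPY}_b(G)) \cong \mathrm{COPY}_b(\mathrm{Bound}_!(G))$, $\mathrm{Bound}_!(\mathrm{KILL}_b(G)) \cong \mathrm{KILL}_b(\mathrm{Bound}_!(G))$ and $\mathrm{Bound}_!(\mathrm{DROP}_b(G)) \cong \mathrm{DROP}_b(\mathrm{Bound}_!(G))$, and the same three isomorphisms hold with $\mathrm{Bound}_!$ replaced by $\mathrm{In}_!$, and with $\mathrm{Bound}_!$ replaced by $\mathrm{Out}_!$.
   Context: Fix a compressed monoidal signature $T=(O,M,\mathrm{dom},\mathrm{cod})$, $\mathrm{dom},\mathrm{cod}: M \rightarrow (O\times\{\mathsf{v},\mathsf{f}\})^*$. The derived compressed typegraph $\mathcal{G}_T$ has vertex set $O\sqcup M$, a self-loop on each $X\in O$, an edge $\mathrm{in}^a_{f,i}$ from $X$ to $f$ for each $f\in M$ and index $i$ with $\mathrm{dom}(f)[i]=(X,a)$, and an edge $\mathrm{out}^a_{f,j}$ from $f$ to $X$ for each index $j$ with $\mathrm{cod}(f)[j]=(X,a)$. $\mathcal{G}_{T!}$ is $\mathcal{G}_T$ plus a vertex $!$, a self-loop on $!$, and an edge from $!$ to each vertex of $\mathcal{G}_T$. For a finite directed multigraph $G$ typed over $\mathcal{G}_{T!}$, vertices typed in $O$, $M$, $!$ are wire-, node-, $!$-vertices ($!(G)$ the set of $!$-vertices); fixed-arity edges are those typed by an $\mathsf{f}$-tagged edge; $U(G)$ deletes $!$-vertices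 and incident edges. A string graph is a $\mathcal{G}_T$-typed graph whose typing restricts at each node-vertex to a bijection on incident fixed-arity edges and whose wire-vertices have at most one incoming and one outgoing edge; its inputs (outputs) are wire-vertices with no incoming (outgoing) edge, and $\mathrm{Bound}$ denotes the set of inputs and outputs. An open subgraph $O'$ of a string graph $K$ is a string subgraph with no vertex adjacent to a wire-vertex outside $O'$ and no incident fixed-arity edge outside $O'$. $B(b)$ is the full subgraph on successors of a $!$-vertex $b$, $\beta(G)$ the full subgraph on $!$-vertices. A $!$-graph is a $\mathcal{G}_{T!}$-typed graph with $U(G)$ a string graph, $\beta(G)$ posetal (at most one edge between two vertices, edge relation a partial order), $U(B(b))$ open in $U(G)$ for each $!$-vertex $b$, and $B(b')\subseteq B(b)$ whenever $b'\in B(b)$. For a subgraph $H$ of $G$, $G\setminus H$ is the full subgraph on vertices not in $H$. Operations: $\mathrm{COPY}_b(G)$ is the pushout in $\mathbf{Graph}/\mathcal{G}_{T!}$ of $G \hookleftarrow G\setminus B(b) \hookrightarrow G$; $\mathrm{DROP}_b(G)=G\setminus\{b\}$; $\mathrm{KILL}_b(G)=G\setminus B(b)$. For a $!$-graph $G$: $\mathrm{In}_!(G)$ is the full subgraph of $G$ on $!(G)$ together with the inputs of $U(G)$; $\mathrm{Out}_!(G)$ is the full subgraph on $!(G)$ together with the outputs of $U(G)$; $\mathrm{Bound}_!(G)$ is the subgraph consisting of $!(G)$, $\mathrm{Bound}(U(G))$, and all edges whose source is in $!(G)$ and whose target is in $!(G)$ or $\mathrm{Bound}(U(G))$. These are $!$-graphs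 containing every $!$-vertex of $G$. *)

theory Defs
  imports "Graph_Theory.Digraph_Component"
begin

section \<open>Compressed monoidal signatures and their typegraphs\<close>

datatype arity_tag = VarArity | FixArity

record ('o, 'm) signature =
  objs :: "'o set"
  mors :: "'m set"
  sdom :: "'m \<Rightarrow> ('o \<times> arity_tag) list"
  scod :: "'m \<Rightarrow> ('o \<times> arity_tag) list"

definition compressed_signature :: "('o, 'm) signature \<Rightarrow> bool" where
  "compressed_signature T \<longleftrightarrow>
     (\<forall>f \<in> mors T. set (sdom T f) \<subseteq> objs T \<times> UNIV \<and> set (scod T f) \<subseteq> objs T \<times> UNIV)"

datatype ('o, 'm) tvertex = Wire 'o | Node 'm | Bang

datatype ('o, 'm) tedge =
    Loop 'o
  | InEdge arity_tag 'm nat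
  | OutEdge arity_tag 'm nat
  | BangLoop
  | BangTo "('o, 'm) tvertex"

fun tedge_tail :: "('o, 'm) signature \<Rightarrow> ('o, 'm) tedge \<Rightarrow> ('o, 'm) tvertex" where
  "tedge_tail T (Loop X) = Wire X"
| "tedge_tail T (InEdge a f i) = Wire (fst (sdom T f ! i))"
| "tedge_tail T (OutEdge a f j) = Node f"
| "tedge_tail T BangLoop = Bang"
| "tedge_tail T (BangTo x) = Bang"

fun tedge_head :: "('o, 'm) signature \<Rightarrow> ('o, 'm) tedge \<Rightarrow> ('o, 'm) tvertex" where
  "tedge_head T (Loop X) = Wire X"
| "tedge_head T (InEdge a f i) = Node f"
| "tedge_head T (OutEdge a f j) = Wire (fst (scod T f ! j))"
| "tedge_head T BangLoop = Bang"
| "tedge_head T (BangTo x) = x"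

definition typegraph :: "('o, 'm) signature \<Rightarrow> (('o, 'm) tvertex, ('o, 'm) tedge) pre_digraph" where
  "typegraph T = \<lparr>
     verts = Wire ` objs T \<union> Node ` mors T,
     arcs = Loop ` objs T
       \<union> {InEdge a f i | a f i. f \<in> mors T \<and> i < length (sdom T f) \<and> snd (sdom T f ! i) = a}
       \<union> {OutEdge a f j | a f j. f \<in> mors T \<and> j < length (scod T f) \<and> snd (scod T f ! j) = a},
     tail = tedge_tail T,
     head = tedge_head T \<rparr>"

definition bang_typegraph :: "('o, 'm) signature \<Rightarrow> (('o, 'm) tvertex, ('o, 'm) tedge) pre_digraph" where
  "bang_typegraph T = \<lparr>
     verts = insert Bang (verts (typegraph T)),
     arcs = arcs (typegraph T) \<union> {BangLoop} \<union> BangTo ` verts (typegraph T),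
     tail = tedge_tail T,
     head = tedge_head T \<rparr>"

fun fixed_arity :: "('o, 'm) tedge \<Rightarrow> bool" where
  "fixed_arity (InEdge a f i) \<longleftrightarrow> a = FixArity"
| "fixed_arity (OutEdge a f j) \<longleftrightarrow> a = FixArity"
| "fixed_arity _ \<longleftrightarrow> False"

section \<open>Finite typed graphs\<close>

record ('v, 'e, 'o, 'm) typed_graph =
  und :: "('v, 'e) pre_digraph"
  vtype :: "'v \<Rightarrow> ('o, 'm) tvertex"
  etype :: "'e \<Rightarrow> ('o, 'm) tedge"

definition typed_over ::
  "(('o, 'm) tvertex, ('o, 'm) tedge) pre_digraph \<Rightarrow> ('v, 'e, 'o, 'm) typed_graph \<Rightarrow> bool" where
  "typed_over K G \<longleftrightarrow> fin_digraph (und G)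
     \<and> (\<forall>v \<in> verts (und G). vtype G v \<in> verts K)
     \<and> (\<forall>e \<in> arcs (und G). etype G e \<in> arcs K
          \<and> tail K (etype G e) = vtype G (tail (und G) e)
          \<and> head K (etype G e) = vtype G (head (und G) e))"

definition tsubgraph :: "('v, 'e, 'o, 'm) typed_graph \<Rightarrow> ('v, 'e, 'o, 'm) typed_graph \<Rightarrow> bool" where
  "tsubgraph H G \<longleftrightarrow> subgraph (und H) (und G)
     \<and> (\<forall>v \<in> verts (und H). vtype H v = vtype G v)
     \<and> (\<forall>e \<in> arcs (und H). etype H e = etype G e)"

definition full_sub :: "('v, 'e, 'o, 'm) typed_graph \<Rightarrow> 'v set \<Rightarrow> ('v, 'e, 'o, 'm) typed_graph" where
  "full_sub G S = G\<lparr>und := und G \<restriction> S\<rparr>"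

definition graph_minus ::
  "('v, 'e, 'o, 'm) typed_graph \<Rightarrow> ('v, 'e, 'o, 'm) typed_graph \<Rightarrow> ('v, 'e, 'o, 'm) typed_graph" where
  "graph_minus G H = full_sub G (verts (und G) - verts (und H))"

section \<open>Morphisms and pushouts of typed graphs\<close>

text \<open>A morphism is a pair of a vertex map and an edge map; only the values on the vertices and
  edges of the source graph matter, so equality of morphisms is \<open>agree\<close> on the source.\<close>

type_synonym ('v, 'e, 'w, 'd) gmap = "('v \<Rightarrow> 'w) \<times> ('e \<Rightarrow> 'd)"

definition tg_hom ::
  "('v, 'e, 'w, 'd) gmap \<Rightarrow> ('v, 'e, 'o, 'm) typed_graph \<Rightarrow> ('w, 'd, 'o, 'm) typed_graph \<Rightarrow> bool" where
  "tg_hom f G H \<longleftrightarrow>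
     (\<forall>v \<in> verts (und G). fst f v \<in> verts (und H) \<and> vtype H (fst f v) = vtype G v)
     \<and> (\<forall>e \<in> arcs (und G). snd f e \<in> arcs (und H) \<and> etype H (snd f e) = etype G e
          \<and> tail (und H) (snd f e) = fst f (tail (und G) e)
          \<and> head (und H) (snd f e) = fst f (head (und G) e))"

definition agree ::
  "('v, 'e, 'o, 'm) typed_graph \<Rightarrow> ('v, 'e, 'w, 'd) gmap \<Rightarrow> ('v, 'e, 'w, 'd) gmap \<Rightarrow> bool" where
  "agree G f g \<longleftrightarrow> (\<forall>v \<in> verts (und G). fst f v = fst g v) \<and> (\<forall>e \<in> arcs (und G). snd f e = snd g e)"

definition gcomp :: "('w, 'd, 'x, 'c) gmap \<Rightarrow> ('v, 'e, 'w, 'd) gmap \<Rightarrow> ('v, 'e, 'x, 'c) gmap"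
    (infixl "\<circ>\<^sub>g" 55) where
  "g \<circ>\<^sub>g f = (fst g \<circ> fst f, snd g \<circ> snd f)"

definition gid :: "('v, 'e, 'v, 'e) gmap" where
  "gid = (id, id)"

definition tg_iso :: "('v, 'e, 'o, 'm) typed_graph \<Rightarrow> ('w, 'd, 'o, 'm) typed_graph \<Rightarrow> bool"
    (infix "\<cong>\<^sub>t" 50) where
  "G \<cong>\<^sub>t H \<longleftrightarrow> (\<exists>f g. tg_hom f G H \<and> tg_hom g H G \<and> agree G (g \<circ>\<^sub>g f) gid \<and> agree H (f \<circ>\<^sub>g g) gid)"

text \<open>\<open>is_pushout K S f g G H i j P\<close>: in the category of finite graphs over \<open>K\<close>, the cocone
  \<open>i : G \<rightarrow> P\<close>, \<open>j : H \<rightarrow> P\<close> is a pushout of the span \<open>f : S \<rightarrow> G\<close>, \<open>g : S \<rightarrow> H\<close>.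
  A definition cannot quantify over types, so the test object \<open>X\<close> ranges over graphs with vertices
  and edges in \<^typ>\<open>nat\<close>; every finite graph is isomorphic to such a graph.  The lemma
  \<open>is_pushout_universal\<close> below gives the universal property for test objects of any type.\<close>

definition is_pushout ::
  "(('o, 'm) tvertex, ('o, 'm) tedge) pre_digraph
   \<Rightarrow> ('s, 'r, 'o, 'm) typed_graph \<Rightarrow> ('s, 'r, 'v, 'e) gmap \<Rightarrow> ('s, 'r, 'w, 'd) gmap
   \<Rightarrow> ('v, 'e, 'o, 'm) typed_graph \<Rightarrow> ('w, 'd, 'o, 'm) typed_graph
   \<Rightarrow> ('v, 'e, 'p, 'q) gmap \<Rightarrow> ('w, 'd, 'p, 'q) gmap
   \<Rightarrow> ('p, 'q, 'o, 'm) typed_graph \<Rightarrow> bool" where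
  "is_pushout K S f g G H i j P \<longleftrightarrow>
     typed_over K S \<and> typed_over K G \<and> typed_over K H \<and> typed_over K P
     \<and> tg_hom f S G \<and> tg_hom g S H \<and> tg_hom i G P \<and> tg_hom j H P
     \<and> agree S (i \<circ>\<^sub>g f) (j \<circ>\<^sub>g g)
     \<and> (\<forall>(X :: (nat, nat, 'o, 'm) typed_graph) h k.
          typed_over K X \<and> tg_hom h G X \<and> tg_hom k H X \<and> agree S (h \<circ>\<^sub>g f) (k \<circ>\<^sub>g g) \<longrightarrow>
          (\<exists>u. tg_hom u P X \<and> agree G (u \<circ>\<^sub>g i) h \<and> agree H (u \<circ>\<^sub>g j) k
             \<and> (\<forall>u'. tg_hom u' P X \<and> agree G (u' \<circ>\<^sub>g i) h \<and> agree H (u' \<circ>\<^sub>g j) k \<longrightarrow> agree P u' u)))"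

section \<open>String graphs\<close>

definition wire_verts :: "('v, 'e, 'o, 'm) typed_graph \<Rightarrow> 'v set" where
  "wire_verts G = {v \<in> verts (und G). \<exists>X. vtype G v = Wire X}"

definition node_verts :: "('v, 'e, 'o, 'm) typed_graph \<Rightarrow> 'v set" where
  "node_verts G = {v \<in> verts (und G). \<exists>f. vtype G v = Node f}"

definition bang_verts :: "('v, 'e, 'o, 'm) typed_graph \<Rightarrow> 'v set" where
  "bang_verts G = {v \<in> verts (und G). vtype G v = Bang}"

definition incident_arcs :: "('v, 'e) pre_digraph \<Rightarrow> 'v \<Rightarrow> 'e set" where
  "incident_arcs D v = in_arcs D v \<union> out_arcs D v"

definition string_graph :: "('o, 'm) signature \<Rightarrow> ('v, 'e, 'o, 'm) typed_graph \<Rightarrow> bool" where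
  "string_graph T K \<longleftrightarrow> typed_over (typegraph T) K
     \<and> (\<forall>v \<in> node_verts K.
          bij_betw (etype K)
            {e \<in> incident_arcs (und K) v. fixed_arity (etype K e)}
            {t \<in> incident_arcs (typegraph T) (vtype K v). fixed_arity t})
     \<and> (\<forall>v \<in> wire_verts K. in_degree (und K) v \<le> 1 \<and> out_degree (und K) v \<le> 1)"

definition inputs :: "('v, 'e, 'o, 'm) typed_graph \<Rightarrow> 'v set" where
  "inputs K = {v \<in> wire_verts K. in_arcs (und K) v = {}}"

definition outputs :: "('v, 'e, 'o, 'm) typed_graph \<Rightarrow> 'v set" where
  "outputs K = {v \<in> wire_verts K. out_arcs (und K) v = {}}"

definition boundary :: "('v, 'e, 'o, 'm) typed_graph \<Rightarrow> 'v set" where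
  "boundary K = inputs K \<union> outputs K"

definition open_subgraph ::
  "('o, 'm) signature \<Rightarrow> ('v, 'e, 'o, 'm) typed_graph \<Rightarrow> ('v, 'e, 'o, 'm) typed_graph \<Rightarrow> bool" where
  "open_subgraph T H K \<longleftrightarrow> tsubgraph H K \<and> string_graph T H
     \<and> (\<forall>u \<in> verts (und H). \<forall>w \<in> wire_verts K - verts (und H).
          (u, w) \<notin> arcs_ends (und K) \<and> (w, u) \<notin> arcs_ends (und K))
     \<and> (\<forall>u \<in> verts (und H). \<forall>e \<in> incident_arcs (und K) u.
          fixed_arity (etype K e) \<longrightarrow> e \<in> arcs (und H))"

section \<open>Bang graphs and operations on them\<close>

definition U :: "('v, 'e, 'o, 'm) typed_graph \<Rightarrow> ('v, 'e, 'o, 'm) typed_graph" where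
  "U G = full_sub G (verts (und G) - bang_verts G)"

definition bang_part :: "('v, 'e, 'o, 'm) typed_graph \<Rightarrow> ('v, 'e, 'o, 'm) typed_graph" where
  "bang_part G = full_sub G (bang_verts G)"

definition B :: "('v, 'e, 'o, 'm) typed_graph \<Rightarrow> 'v \<Rightarrow> ('v, 'e, 'o, 'm) typed_graph" where
  "B G b = full_sub G {v. (b, v) \<in> arcs_ends (und G)}"

definition posetal :: "('v, 'e) pre_digraph \<Rightarrow> bool" where
  "posetal D \<longleftrightarrow> nomulti_digraph D \<and> partial_order_on (verts D) (arcs_ends D)"

definition bang_graph :: "('o, 'm) signature \<Rightarrow> ('v, 'e, 'o, 'm) typed_graph \<Rightarrow> bool" where
  "bang_graph T G \<longleftrightarrow> typed_over (bang_typegraph T) G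
     \<and> string_graph T (U G)
     \<and> posetal (und (bang_part G))
     \<and> (\<forall>b \<in> bang_verts G. open_subgraph T (U (B G b)) (U G))
     \<and> (\<forall>b \<in> bang_verts G. \<forall>b' \<in> bang_verts G.
          b' \<in> verts (und (B G b)) \<longrightarrow> tsubgraph (B G b') (B G b))"

text \<open>A pushout is determined only up to isomorphism, so \<open>COPY\<close> is a relation between a graph
  and its pushouts; \<open>is_COPY_exists\<close> and \<open>typed_over_bang_interfaces\<close> below show that
  the copies of a graph and of its three interfaces exist.\<close>

definition is_COPY ::
  "('o, 'm) signature \<Rightarrow> 'v \<Rightarrow> ('v, 'e, 'o, 'm) typed_graph \<Rightarrow> ('w, 'd, 'o, 'm) typed_graph \<Rightarrow> bool" where
  "is_COPY T b G P \<longleftrightarrow>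
     (\<exists>i j. is_pushout (bang_typegraph T) (graph_minus G (B G b)) gid gid G G i j P)"

definition DROP :: "'v \<Rightarrow> ('v, 'e, 'o, 'm) typed_graph \<Rightarrow> ('v, 'e, 'o, 'm) typed_graph" where
  "DROP b G = graph_minus G (full_sub G {b})"

definition KILL :: "'v \<Rightarrow> ('v, 'e, 'o, 'm) typed_graph \<Rightarrow> ('v, 'e, 'o, 'm) typed_graph" where
  "KILL b G = graph_minus G (B G b)"

definition In_bang :: "('v, 'e, 'o, 'm) typed_graph \<Rightarrow> ('v, 'e, 'o, 'm) typed_graph" where
  "In_bang G = full_sub G (bang_verts G \<union> inputs (U G))"

definition Out_bang :: "('v, 'e, 'o, 'm) typed_graph \<Rightarrow> ('v, 'e, 'o, 'm) typed_graph" where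
  "Out_bang G = full_sub G (bang_verts G \<union> outputs (U G))"

definition Bound_bang :: "('v, 'e, 'o, 'm) typed_graph \<Rightarrow> ('v, 'e, 'o, 'm) typed_graph" where
  "Bound_bang G = G\<lparr>und := \<lparr>
     verts = bang_verts G \<union> boundary (U G),
     arcs = {e \<in> arcs (und G). tail (und G) e \<in> bang_verts G
               \<and> head (und G) e \<in> bang_verts G \<union> boundary (U G)},
     tail = tail (und G),
     head = head (und G) \<rparr>\<rparr>"

section \<open>Sanity checks for pushouts and copying\<close>

lemma is_pushout_universal:
  fixes X :: "('x, 'y, 'o, 'm) typed_graph"
  assumes po: "is_pushout K S f g G H i j P"
    and X: "typed_over K X" "tg_hom h G X" "tg_hom k H X" "agree S (h \<circ>\<^sub>g f) (k \<circ>\<^sub>g g)"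
  shows "\<exists>u. tg_hom u P X \<and> agree G (u \<circ>\<^sub>g i) h \<and> agree H (u \<circ>\<^sub>g j) k
             \<and> (\<forall>u'. tg_hom u' P X \<and> agree G (u' \<circ>\<^sub>g i) h \<and> agree H (u' \<circ>\<^sub>g j) k \<longrightarrow> agree P u' u)"
proof -
  interpret X: fin_digraph "und X" using X(1) by (simp add: typed_over_def)
  obtain p :: "'x \<Rightarrow> nat" where p: "inj_on p (verts (und X))"
    using finite_imp_inj_to_nat_seg[OF X.finite_verts] by blast
  obtain q :: "'y \<Rightarrow> nat" where q: "inj_on q (arcs (und X))"
    using finite_imp_inj_to_nat_seg[OF X.finite_arcs] by blast
  define p' where "p' = the_inv_into (verts (und X)) p"
  define q' where "q' = the_inv_into (arcs (und X)) q"
  have p': "\<And>v. v \<in> verts (und X) \<Longrightarrow> p' (p v) = v"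
    unfolding p'_def by (rule the_inv_into_f_f[OF p])
  have q': "\<And>e. e \<in> arcs (und X) \<Longrightarrow> q' (q e) = e"
    unfolding q'_def by (rule the_inv_into_f_f[OF q])
  define Y where "Y = \<lparr>und = \<lparr>verts = p ` verts (und X), arcs = q ` arcs (und X),
      tail = p \<circ> tail (und X) \<circ> q', head = p \<circ> head (und X) \<circ> q'\<rparr>,
      vtype = vtype X \<circ> p', etype = etype X \<circ> q'\<rparr>"
  have Y: "typed_over K Y"
    using X(1) unfolding typed_over_def Y_def
    by (auto simp: p' q' fin_digraph_def wf_digraph_def fin_digraph_axioms_def)
  have pq: "tg_hom (p, q) X Y" and pq': "tg_hom (p', q') Y X"
    unfolding tg_hom_def Y_def by (auto simp: p' q')
  have wfs: "wf_digraph (und G)" "wf_digraph (und H)" "wf_digraph (und P)"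
    using po by (auto simp: is_pushout_def typed_over_def fin_digraph_def)
  have homs: "tg_hom i G P" "tg_hom j H P" "tg_hom f S G" "tg_hom g S H"
    using po by (auto simp: is_pushout_def)
  have h': "tg_hom ((p, q) \<circ>\<^sub>g h) G Y" "tg_hom ((p, q) \<circ>\<^sub>g k) H Y"
    using X(2,3) pq wfs unfolding tg_hom_def gcomp_def by (auto simp: wf_digraph_def)
  have ag: "agree S ((p, q) \<circ>\<^sub>g h \<circ>\<^sub>g f) ((p, q) \<circ>\<^sub>g k \<circ>\<^sub>g g)"
    using X(4) unfolding agree_def gcomp_def by auto
  obtain u where u: "tg_hom u P Y" "agree G (u \<circ>\<^sub>g i) ((p, q) \<circ>\<^sub>g h)" "agree H (u \<circ>\<^sub>g j) ((p, q) \<circ>\<^sub>g k)"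
    and uniq: "\<And>u'. tg_hom u' P Y \<and> agree G (u' \<circ>\<^sub>g i) ((p, q) \<circ>\<^sub>g h)
        \<and> agree H (u' \<circ>\<^sub>g j) ((p, q) \<circ>\<^sub>g k) \<Longrightarrow> agree P u' u"
    using po Y h' ag unfolding is_pushout_def by blast
  show ?thesis
  proof (intro exI[of _ "(p', q') \<circ>\<^sub>g u"] conjI allI impI)
    show "tg_hom ((p', q') \<circ>\<^sub>g u) P X"
      using u(1) pq' wfs unfolding tg_hom_def gcomp_def by (auto simp: wf_digraph_def)
    show "agree G ((p', q') \<circ>\<^sub>g u \<circ>\<^sub>g i) h"
      using u(2) X(2) unfolding agree_def gcomp_def tg_hom_def by (auto simp: p' q')
    show "agree H ((p', q') \<circ>\<^sub>g u \<circ>\<^sub>g j) k"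
      using u(3) X(3) unfolding agree_def gcomp_def tg_hom_def by (auto simp: p' q')
    fix u' assume u': "tg_hom u' P X \<and> agree G (u' \<circ>\<^sub>g i) h \<and> agree H (u' \<circ>\<^sub>g j) k"
    have "agree P ((p, q) \<circ>\<^sub>g u') u"
    proof (rule uniq, intro conjI)
      show "tg_hom ((p, q) \<circ>\<^sub>g u') P Y"
        using u' pq wfs unfolding tg_hom_def gcomp_def by (auto simp: wf_digraph_def)
    qed (use u' in \<open>auto simp: agree_def gcomp_def\<close>)
    then show "agree P u' ((p', q') \<circ>\<^sub>g u)"
      using u' unfolding agree_def gcomp_def tg_hom_def by (auto simp: p' q')
        (metis p', metis q')
  qed
qed

lemma is_COPY_exists:
  fixes G :: "('v, 'e, 'o, 'm) typed_graph"
  assumes G: "typed_over (bang_typegraph T) G"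
  shows "\<exists>P :: ('v \<times> bool, 'e \<times> bool, 'o, 'm) typed_graph. is_COPY T b G P"
proof -
  let ?K = "bang_typegraph T"
  interpret G: fin_digraph "und G" using G by (simp add: typed_over_def)
  define S where "S = graph_minus G (B G b)"
  define D where "D = verts (und (B G b))"
  define sv where "sv = (\<lambda>v (s::bool). (v, s \<and> v \<in> D))"
  define se where "se = (\<lambda>e (s::bool). (e, s \<and> (tail (und G) e \<in> D \<or> head (und G) e \<in> D)))"
  have DG: "D \<subseteq> verts (und G)"
    by (auto simp: D_def B_def full_sub_def arcs_ends_conv)
  have S: "verts (und S) = verts (und G) - D"
      "arcs (und S) = {e \<in> arcs (und G). tail (und G) e \<notin> D \<and> head (und G) e \<notin> D}"
      "tail (und S) = tail (und G)" "head (und S) = head (und G)"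
      "vtype S = vtype G" "etype S = etype G"
    by (auto simp: S_def D_def graph_minus_def full_sub_def)
  define P where "P = \<lparr>und = \<lparr>verts = (\<lambda>(v, s). sv v s) ` (verts (und G) \<times> UNIV),
      arcs = (\<lambda>(e, s). se e s) ` (arcs (und G) \<times> UNIV),
      tail = (\<lambda>(e, s). sv (tail (und G) e) s), head = (\<lambda>(e, s). sv (head (und G) e) s)\<rparr>,
      vtype = vtype G \<circ> fst, etype = etype G \<circ> fst\<rparr>"
  define inc where "inc = (\<lambda>s::bool. ((\<lambda>v. sv v s), (\<lambda>e. se e s)))"
  have SK: "typed_over ?K S"
    using G unfolding typed_over_def fin_digraph_def wf_digraph_def fin_digraph_axioms_def
    by (auto simp: S)
  have PK: "typed_over ?K P"
    using G unfolding typed_over_def fin_digraph_def wf_digraph_def fin_digraph_axioms_def P_def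
    by (auto simp: sv_def se_def)
  have idS: "tg_hom gid S G"
    by (auto simp: tg_hom_def gid_def S)
  have inc: "tg_hom (inc s) G P" for s
    by (auto simp: tg_hom_def inc_def P_def sv_def se_def)
  have incS: "agree S (inc False \<circ>\<^sub>g gid) (inc True \<circ>\<^sub>g gid)"
    by (auto simp: agree_def inc_def gcomp_def gid_def S sv_def se_def)
  have univ: "\<exists>u. tg_hom u P X \<and> agree G (u \<circ>\<^sub>g inc False) h \<and> agree G (u \<circ>\<^sub>g inc True) k
     \<and> (\<forall>u'. tg_hom u' P X \<and> agree G (u' \<circ>\<^sub>g inc False) h \<and> agree G (u' \<circ>\<^sub>g inc True) k
          \<longrightarrow> agree P u' u)"
    if h: "tg_hom h G X" and k: "tg_hom k G X" and hk: "agree S (h \<circ>\<^sub>g gid) (k \<circ>\<^sub>g gid)"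
    for X :: "(nat, nat, 'o, 'm) typed_graph" and h k
  proof -
    define u where "u = ((\<lambda>(v, s). fst (if s then k else h) v), (\<lambda>(e, s). snd (if s then k else h) e))"
    have hkv: "fst h v = fst k v" if "v \<in> verts (und G)" "v \<notin> D" for v
      using hk that by (auto simp: agree_def gcomp_def gid_def S)
    have hke: "snd h e = snd k e"
      if "e \<in> arcs (und G)" "tail (und G) e \<notin> D" "head (und G) e \<notin> D" for e
      using hk that by (auto simp: agree_def gcomp_def gid_def S)
    have 1: "tg_hom u P X"
      using h k hkv unfolding tg_hom_def u_def P_def by (auto simp: sv_def se_def)
    have 2: "agree G (u \<circ>\<^sub>g inc False) h"
      by (auto simp: agree_def gcomp_def u_def inc_def sv_def se_def)
    have 3: "agree G (u \<circ>\<^sub>g inc True) k"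
      using hkv hke by (auto simp: agree_def gcomp_def u_def inc_def sv_def se_def)
    have 4: "agree P u' u"
      if "agree G (u' \<circ>\<^sub>g inc False) h" "agree G (u' \<circ>\<^sub>g inc True) k" for u'
    proof -
      have a: "fst u' (sv v s) = fst u (sv v s)" if "v \<in> verts (und G)" for v s
        using \<open>agree G (u' \<circ>\<^sub>g inc False) h\<close> \<open>agree G (u' \<circ>\<^sub>g inc True) k\<close> 2 3 that
        by (cases s) (auto simp: agree_def gcomp_def inc_def)
      have b: "snd u' (se e s) = snd u (se e s)" if "e \<in> arcs (und G)" for e s
        using \<open>agree G (u' \<circ>\<^sub>g inc False) h\<close> \<open>agree G (u' \<circ>\<^sub>g inc True) k\<close> 2 3 that
        by (cases s) (auto simp: agree_def gcomp_def inc_def)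
      show ?thesis using a b by (auto simp: agree_def P_def)
    qed
    show ?thesis using 1 2 3 4 by blast
  qed
  have "is_pushout ?K S gid gid G G (inc False) (inc True) P"
    unfolding is_pushout_def using SK G PK idS inc incS univ by blast
  then show ?thesis unfolding is_COPY_def S_def by blast
qed

lemma typed_over_bang_interfaces:
  assumes "typed_over K G"
  shows "typed_over K (Bound_bang G)" "typed_over K (In_bang G)" "typed_over K (Out_bang G)"
proof -
  have "bang_verts G \<subseteq> verts (und G)" "inputs (U G) \<subseteq> verts (und G)" "outputs (U G) \<subseteq> verts (und G)"
    by (auto simp: bang_verts_def inputs_def outputs_def wire_verts_def U_def full_sub_def)
  then show "typed_over K (Bound_bang G)" "typed_over K (In_bang G)" "typed_over K (Out_bang G)"
    using assms finite_subset[of _ "verts (und G)"]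
    unfolding typed_over_def fin_digraph_def wf_digraph_def fin_digraph_axioms_def
      Bound_bang_def In_bang_def Out_bang_def full_sub_def boundary_def
    by (auto simp: subset_iff)
qed

end

theory Submission
  imports Defs
begin

text \<open>All three interfaces keep the \<open>!\<close>-vertices, a set \<open>S\<close> of boundary wire-vertices, and exactly the
  edges leaving a \<open>!\<close>-vertex: an edge of \<open>G\<close> between two inputs (or two outputs) would contradict their
  being inputs (outputs), and no edge runs from a wire-vertex to a \<open>!\<close>-vertex.  So it suffices to
  follow the sets of inputs and outputs through the operations.  Removing a \<open>!\<close>-vertex does not change
  \<open>U G\<close>; in a copy, each wire-vertex keeps the incoming and outgoing edges of its original; and removing
  \<open>B(b)\<close> creates no new boundary since no wire-vertex outside the open subgraph \<open>U(B(b))\<close> is adjacent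
  to it.  The universal property replaces an arbitrary pushout by an explicit one.\<close>

section \<open>Isomorphisms and uniqueness of pushouts\<close>

lemma tg_hom_gcomp:
  assumes "tg_hom f G H" "tg_hom g H K" "wf_digraph (und G)"
  shows "tg_hom (g \<circ>\<^sub>g f) G K"
  using assms unfolding tg_hom_def gcomp_def by (auto simp: wf_digraph_def)

lemma tg_iso_trans:
  assumes "G \<cong>\<^sub>t H" "H \<cong>\<^sub>t K" "wf_digraph (und G)" "wf_digraph (und K)"
  shows "G \<cong>\<^sub>t K"
proof -
  obtain f g where f: "tg_hom f G H" "tg_hom g H G" "agree G (g \<circ>\<^sub>g f) gid" "agree H (f \<circ>\<^sub>g g) gid"
    using assms(1) unfolding tg_iso_def by blast
  obtain f' g' where f': "tg_hom f' H K" "tg_hom g' K H" "agree H (g' \<circ>\<^sub>g f') gid" "agree K (f' \<circ>\<^sub>g g') gid"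
    using assms(2) unfolding tg_iso_def by blast
  have "agree G ((g \<circ>\<^sub>g g') \<circ>\<^sub>g (f' \<circ>\<^sub>g f)) gid" "agree K ((f' \<circ>\<^sub>g f) \<circ>\<^sub>g (g \<circ>\<^sub>g g')) gid"
    using f f' unfolding agree_def gcomp_def gid_def tg_hom_def by auto
  moreover have "tg_hom (f' \<circ>\<^sub>g f) G K" "tg_hom (g \<circ>\<^sub>g g') K G"
    using f f' assms(3,4) by (auto intro: tg_hom_gcomp)
  ultimately show ?thesis unfolding tg_iso_def by blast
qed

lemma typed_over_wf: "typed_over K G \<Longrightarrow> wf_digraph (und G)"
  by (simp add: typed_over_def fin_digraph_def)

text \<open>Both \<open>u\<close> and the identity mediate from the pushout cocone to itself, so
  uniqueness identifies them. The test object is \<open>P\<close>, whose types are arbitrary; this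
  is why \<open>is_pushout_universal\<close> is invoked rather than the defining clause, which tests
  only against graphs over \<open>nat\<close>.\<close>

lemma pushout_endo_id:
  assumes po: "is_pushout K S f g G H i j P"
    and u: "tg_hom u P P" "agree G (u \<circ>\<^sub>g i) i" "agree H (u \<circ>\<^sub>g j) j"
  shows "agree P u gid"
proof -
  have "typed_over K P" "tg_hom i G P" "tg_hom j H P" "agree S (i \<circ>\<^sub>g f) (j \<circ>\<^sub>g g)"
    using po unfolding is_pushout_def by blast+
  from is_pushout_universal[OF po this] obtain w
    where w: "\<And>u'. tg_hom u' P P \<and> agree G (u' \<circ>\<^sub>g i) i \<and> agree H (u' \<circ>\<^sub>g j) j \<Longrightarrow> agree P u' w"
    by blast
  have "agree P u w" using w u by blast
  moreover have "agree P gid w"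
    by (rule w) (auto simp: tg_hom_def agree_def gid_def gcomp_def)
  ultimately show ?thesis by (simp add: agree_def)
qed

text \<open>The mediating maps in the two directions are mutually inverse, since each composite is
  an endomorphism of a pushout that fixes its cocone.\<close>

lemma pushout_unique:
  assumes po: "is_pushout K S f g G H i j P" and po': "is_pushout K S f g G H i' j' P'"
  shows "P \<cong>\<^sub>t P'"
proof -
  have c: "typed_over K P" "tg_hom i G P" "tg_hom j H P" "agree S (i \<circ>\<^sub>g f) (j \<circ>\<^sub>g g)"
    using po unfolding is_pushout_def by blast+
  have c': "typed_over K P'" "tg_hom i' G P'" "tg_hom j' H P'" "agree S (i' \<circ>\<^sub>g f) (j' \<circ>\<^sub>g g)"
    using po' unfolding is_pushout_def by blast+
  obtain u where u: "tg_hom u P P'" "agree G (u \<circ>\<^sub>g i) i'" "agree H (u \<circ>\<^sub>g j) j'"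
    using is_pushout_universal[OF po c'] by blast
  obtain w where w: "tg_hom w P' P" "agree G (w \<circ>\<^sub>g i') i" "agree H (w \<circ>\<^sub>g j') j"
    using is_pushout_universal[OF po' c] by blast
  have "agree P (w \<circ>\<^sub>g u) gid"
    by (rule pushout_endo_id[OF po tg_hom_gcomp[OF u(1) w(1) typed_over_wf[OF c(1)]]])
       (use u w in \<open>auto simp: agree_def gcomp_def\<close>)
  moreover have "agree P' (u \<circ>\<^sub>g w) gid"
    by (rule pushout_endo_id[OF po' tg_hom_gcomp[OF w(1) u(1) typed_over_wf[OF c'(1)]]])
       (use u w in \<open>auto simp: agree_def gcomp_def\<close>)
  ultimately show ?thesis using u w unfolding tg_iso_def by blast
qed

lemma is_COPY_unique: "is_COPY T b G P \<Longrightarrow> is_COPY T b G Q \<Longrightarrow> P \<cong>\<^sub>t Q"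
  unfolding is_COPY_def by (blast intro: pushout_unique)

lemma is_COPY_typed_over: "is_COPY T b G P \<Longrightarrow> typed_over (bang_typegraph T) P"
  unfolding is_COPY_def is_pushout_def by (elim exE conjE)

section \<open>An explicit copy\<close>

text \<open>The tag \<open>True\<close> marks the second copy; it occurs only on vertices of \<open>D\<close> and edges meeting \<open>D\<close>.\<close>

definition copy_graph ::
  "'v set \<Rightarrow> ('v, 'e, 'o, 'm) typed_graph \<Rightarrow> ('v \<times> bool, 'e \<times> bool, 'o, 'm) typed_graph" where
  "copy_graph D G = \<lparr>und = \<lparr>
     verts = {(v, s). v \<in> verts (und G) \<and> (s \<longrightarrow> v \<in> D)},
     arcs = {(e, s). e \<in> arcs (und G) \<and> (s \<longrightarrow> tail (und G) e \<in> D \<or> head (und G) e \<in> D)},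
     tail = (\<lambda>(e, s). (tail (und G) e, s \<and> tail (und G) e \<in> D)),
     head = (\<lambda>(e, s). (head (und G) e, s \<and> head (und G) e \<in> D))\<rparr>,
     vtype = vtype G \<circ> fst, etype = etype G \<circ> fst\<rparr>"

lemma typed_over_copy_graph:
  assumes "typed_over K G"
  shows "typed_over K (copy_graph D G)"
proof -
  have "finite (verts (und G) \<times> (UNIV :: bool set))" "finite (arcs (und G) \<times> (UNIV :: bool set))"
    using assms by (auto simp: typed_over_def fin_digraph_def fin_digraph_axioms_def)
  then have "finite (verts (und (copy_graph D G)))" "finite (arcs (und (copy_graph D G)))"
    by (auto simp: copy_graph_def elim!: finite_subset[rotated])
  then show ?thesis
    using assms unfolding typed_over_def fin_digraph_def wf_digraph_def fin_digraph_axioms_def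
    by (auto simp: copy_graph_def)
qed

lemma typed_over_full_sub:
  assumes "typed_over K G" "V \<subseteq> verts (und G)"
  shows "typed_over K (full_sub G V)"
  using assms finite_subset[of V "verts (und G)"]
  unfolding typed_over_def fin_digraph_def wf_digraph_def fin_digraph_axioms_def
  by (auto simp: full_sub_def)

text \<open>The two inclusions of \<open>G\<close> agree exactly on what avoids \<open>D\<close> and
  jointly cover the copy, so a compatible pair of maps glues in only one way.
  \<open>is_COPY_exists\<close> asserts only that some copy exists; a named graph is needed here
  because its boundary has to be computed.\<close>

lemma is_COPY_copy_graph:
  fixes G :: "('v, 'e, 'o, 'm) typed_graph"
  assumes G: "typed_over (bang_typegraph T) G"
  shows "is_COPY T b G (copy_graph (verts (und (B G b))) G)"
proof -
  define D where "D = verts (und (B G b))"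
  define S where "S = graph_minus G (B G b)"
  define inc :: "bool \<Rightarrow> ('v, 'e, 'v \<times> bool, 'e \<times> bool) gmap" where
    "inc = (\<lambda>s. (\<lambda>v. (v, s \<and> v \<in> D), \<lambda>e. (e, s \<and> (tail (und G) e \<in> D \<or> head (und G) e \<in> D))))"
  let ?P = "copy_graph D G"
  have S: "verts (und S) = verts (und G) - D"
      "arcs (und S) = {e \<in> arcs (und G). tail (und G) e \<notin> D \<and> head (und G) e \<notin> D}"
      "tail (und S) = tail (und G)" "head (und S) = head (und G)" "vtype S = vtype G" "etype S = etype G"
    using typed_over_wf[OF G]
    by (auto simp: S_def D_def graph_minus_def full_sub_def wf_digraph_def)
  have inc: "tg_hom (inc s) G ?P" for s
    by (auto simp: tg_hom_def inc_def copy_graph_def)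
  have univ: "\<exists>u. tg_hom u ?P X \<and> agree G (u \<circ>\<^sub>g inc False) h \<and> agree G (u \<circ>\<^sub>g inc True) k
     \<and> (\<forall>u'. tg_hom u' ?P X \<and> agree G (u' \<circ>\<^sub>g inc False) h \<and> agree G (u' \<circ>\<^sub>g inc True) k
          \<longrightarrow> agree ?P u' u)"
    if h: "tg_hom h G X" and k: "tg_hom k G X" and hk: "agree S (h \<circ>\<^sub>g gid) (k \<circ>\<^sub>g gid)"
    for X :: "(nat, nat, 'o, 'm) typed_graph" and h k
  proof (intro exI conjI allI impI)
    \<comment> \<open>The first copy is mapped by \<open>h\<close> and the second by
      \<open>k\<close>. An edge tagged \<open>True\<close> with one end outside \<open>D\<close> is
      mapped by \<open>k\<close> while that end is mapped by \<open>h\<close>; \<open>hkv\<close>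
      makes the two consistent.\<close>
    let ?u = "(\<lambda>(v, s). fst (if s then k else h) v, \<lambda>(e, s). snd (if s then k else h) e)"
    have hkv: "fst h v = fst k v" if "v \<in> verts (und G)" "v \<notin> D" for v
      using hk that by (auto simp: agree_def gcomp_def gid_def S)
    have hke: "snd h e = snd k e"
      if "e \<in> arcs (und G)" "tail (und G) e \<notin> D" "head (und G) e \<notin> D" for e
      using hk that by (auto simp: agree_def gcomp_def gid_def S)
    show "tg_hom ?u ?P X"
      using h k hkv typed_over_wf[OF G] unfolding tg_hom_def copy_graph_def
      by (auto simp: wf_digraph_def)
    show "agree G (?u \<circ>\<^sub>g inc False) h" "agree G (?u \<circ>\<^sub>g inc True) k"
      using hkv hke by (auto simp: agree_def gcomp_def inc_def)
    fix u' assume "tg_hom u' ?P X \<and> agree G (u' \<circ>\<^sub>g inc False) h \<and> agree G (u' \<circ>\<^sub>g inc True) k"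
    then have F: "agree G (u' \<circ>\<^sub>g inc False) h" and T: "agree G (u' \<circ>\<^sub>g inc True) k"
      by simp_all
    \<comment> \<open>Uniqueness: each vertex and edge of the copy is the image of one of
      \<open>G\<close> under some inclusion, so its value under \<open>u'\<close> is forced. The tag
      \<open>True\<close> requires membership in \<open>D\<close>, or an end in \<open>D\<close>,
      because elsewhere \<open>inc True\<close> yields the tag \<open>False\<close>.\<close>
    have *: "fst u' (v, False) = fst h v" if "v \<in> verts (und G)" for v
      using F that by (simp add: agree_def gcomp_def inc_def)
    have **: "fst u' (v, True) = fst k v" if "v \<in> verts (und G)" "v \<in> D" for v
      using bspec[OF conjunct1[OF T[unfolded agree_def]] that(1)] that(2)
      by (simp add: gcomp_def inc_def)
    have ***: "snd u' (e, False) = snd h e" if "e \<in> arcs (und G)" for e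
      using F that by (simp add: agree_def gcomp_def inc_def)
    have ****: "snd u' (e, True) = snd k e"
      if "e \<in> arcs (und G)" "tail (und G) e \<in> D \<or> head (und G) e \<in> D" for e
      using bspec[OF conjunct2[OF T[unfolded agree_def]] that(1)] that(2)
      by (simp add: gcomp_def inc_def)
    show "agree ?P u' ?u"
      by (auto simp: agree_def copy_graph_def * ** *** ****)
  qed
  have "is_pushout (bang_typegraph T) S gid gid G G (inc False) (inc True) ?P"
    unfolding is_pushout_def
  proof (intro conjI allI impI)
    show "typed_over (bang_typegraph T) S"
      unfolding S_def graph_minus_def using G by (auto intro: typed_over_full_sub)
    show "tg_hom gid S G" "tg_hom gid S G"
      by (auto simp: tg_hom_def gid_def S)
    show "agree S (inc False \<circ>\<^sub>g gid) (inc True \<circ>\<^sub>g gid)"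
      by (auto simp: agree_def inc_def gcomp_def gid_def S)
  qed (use G inc univ typed_over_copy_graph[OF G] in \<open>blast+\<close>)
  then show ?thesis unfolding is_COPY_def S_def D_def by blast
qed

section \<open>Interfaces\<close>

text \<open>The set \<open>S\<close> is a parameter so that one argument about copying, killing and
  dropping serves inputs, outputs and their union.\<close>

definition interface :: "('v, 'e, 'o, 'm) typed_graph \<Rightarrow> 'v set \<Rightarrow> ('v, 'e, 'o, 'm) typed_graph" where
  "interface G S = G\<lparr>und := \<lparr>
     verts = bang_verts G \<union> S,
     arcs = {e \<in> arcs (und G). tail (und G) e \<in> bang_verts G \<and> head (und G) e \<in> bang_verts G \<union> S},
     tail = tail (und G),
     head = head (und G) \<rparr>\<rparr>"

text \<open>Passing to \<open>U G\<close> discards exactly the edges that touch a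
  \<open>!\<close>-vertex, so having no incoming edge there means that every incoming edge in
  \<open>G\<close> starts at a \<open>!\<close>-vertex. This turns later claims into conditions on
  the edges of \<open>G\<close> itself.\<close>

lemma inputs_U:
  assumes "wf_digraph (und G)"
  shows "inputs (U G) = {v \<in> verts (und G). (\<exists>X. vtype G v = Wire X) \<and>
    (\<forall>e \<in> arcs (und G). head (und G) e = v \<longrightarrow> vtype G (tail (und G) e) = Bang)}"
  using assms
  by (auto simp: inputs_def U_def full_sub_def wire_verts_def bang_verts_def in_arcs_def wf_digraph_def)

lemma outputs_U:
  assumes "wf_digraph (und G)"
  shows "outputs (U G) = {v \<in> verts (und G). (\<exists>X. vtype G v = Wire X) \<and>
    (\<forall>e \<in> arcs (und G). tail (und G) e = v \<longrightarrow> vtype G (head (und G) e) = Bang)}"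
  using assms
  by (auto simp: outputs_def U_def full_sub_def wire_verts_def bang_verts_def out_arcs_def wf_digraph_def)

text \<open>Of the typegraph edges only \<open>BangLoop\<close> and \<open>BangTo\<close> can end at
  \<open>Bang\<close>, and both start there.\<close>

lemma bang_head_imp_bang_tail:
  assumes "typed_over (bang_typegraph T) G" "e \<in> arcs (und G)" "vtype G (head (und G) e) = Bang"
  shows "vtype G (tail (und G) e) = Bang"
proof -
  have "tedge_head T (etype G e) = Bang" "tedge_tail T (etype G e) = vtype G (tail (und G) e)"
    using assms by (auto simp: typed_over_def bang_typegraph_def)
  then show ?thesis by (cases "etype G e") auto
qed

section \<open>The three interfaces as instances of one construction\<close>

lemma Bound_bang_eq_interface: "Bound_bang G = interface G (boundary (U G))"
  by (simp add: Bound_bang_def interface_def)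

lemma In_bang_eq_interface:
  assumes "typed_over (bang_typegraph T) G"
  shows "In_bang G = interface G (inputs (U G))"
proof -
  have "tail (und G) e \<in> bang_verts G"
    if "e \<in> arcs (und G)" "head (und G) e \<in> bang_verts G \<union> inputs (U G)" for e
    using that bang_head_imp_bang_tail[OF assms, of e] typed_over_wf[OF assms]
    by (auto simp: inputs_U bang_verts_def wf_digraph_def)
  then have "arcs (und (In_bang G)) = arcs (und (interface G (inputs (U G))))"
    by (auto simp: In_bang_def full_sub_def interface_def)
  then show ?thesis
    by (simp add: In_bang_def interface_def full_sub_def induce_subgraph_def)
qed

text \<open>An edge leaving an output would have to end at a \<open>!\<close>-vertex and hence also
  start at one, so the edges of the full subgraph all start at \<open>!\<close>-vertices.\<close>

lemma Out_bang_eq_interface: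
  assumes "typed_over (bang_typegraph T) G"
  shows "Out_bang G = interface G (outputs (U G))"
proof -
  have "tail (und G) e \<in> bang_verts G"
    if "e \<in> arcs (und G)" "tail (und G) e \<in> bang_verts G \<union> outputs (U G)" for e
    using that bang_head_imp_bang_tail[OF assms, of e] typed_over_wf[OF assms]
    by (auto simp: outputs_U bang_verts_def wf_digraph_def)
  then have "arcs (und (Out_bang G)) = arcs (und (interface G (outputs (U G))))"
    by (auto simp: Out_bang_def full_sub_def interface_def)
  then show ?thesis
    by (simp add: Out_bang_def interface_def full_sub_def induce_subgraph_def)
qed

lemma typed_over_interface:
  assumes "typed_over K G" "S \<subseteq> verts (und G)"
  shows "typed_over K (interface G S)"
  using assms finite_subset[of "bang_verts G \<union> S" "verts (und G)"]
  unfolding typed_over_def fin_digraph_def wf_digraph_def fin_digraph_axioms_def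
  by (auto simp: interface_def bang_verts_def)

lemma boundary_verts:
  "inputs (U G) \<subseteq> verts (und G)" "outputs (U G) \<subseteq> verts (und G)" "boundary (U G) \<subseteq> verts (und G)"
  by (auto simp: boundary_def inputs_def outputs_def wire_verts_def U_def full_sub_def)

lemma boundary_not_bang:
  "inputs (U G) \<inter> bang_verts G = {}" "outputs (U G) \<inter> bang_verts G = {}"
  "boundary (U G) \<inter> bang_verts G = {}"
  by (auto simp: boundary_def inputs_def outputs_def wire_verts_def U_def full_sub_def bang_verts_def)

section \<open>Invariance of the interfaces under isomorphism\<close>

lemma iso_inputs:
  assumes "wf_digraph (und G)" "wf_digraph (und H)"
    and "tg_hom f G H" "tg_hom g H G" "agree G (g \<circ>\<^sub>g f) gid" "v \<in> inputs (U G)"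
  shows "fst f v \<in> inputs (U H)"
proof -
  have "vtype H (tail (und H) e) = Bang" if "e \<in> arcs (und H)" "head (und H) e = fst f v" for e
  proof -
    \<comment> \<open>The edge into \<open>fst f v\<close> is pulled back along \<open>g\<close> to
      an edge into \<open>v\<close>; typing is preserved, so its tail has the same type.\<close>
    have "snd g e \<in> arcs (und G)" "head (und G) (snd g e) = v"
      "vtype G (tail (und G) (snd g e)) = vtype H (tail (und H) e)"
      using that assms
      by (auto simp: tg_hom_def agree_def gcomp_def gid_def inputs_U wf_digraph_def)
    then show ?thesis using assms(1,6) by (auto simp: inputs_U)
  qed
  then show ?thesis using assms by (auto simp: inputs_U tg_hom_def)
qed

lemma iso_outputs:
  assumes "wf_digraph (und G)" "wf_digraph (und H)"
    and "tg_hom f G H" "tg_hom g H G" "agree G (g \<circ>\<^sub>g f) gid" "v \<in> outputs (U G)"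
  shows "fst f v \<in> outputs (U H)"
proof -
  have "vtype H (head (und H) e) = Bang" if "e \<in> arcs (und H)" "tail (und H) e = fst f v" for e
  proof -
    have "snd g e \<in> arcs (und G)" "tail (und G) (snd g e) = v"
      "vtype G (head (und G) (snd g e)) = vtype H (head (und H) e)"
      using that assms
      by (auto simp: tg_hom_def agree_def gcomp_def gid_def outputs_U wf_digraph_def)
    then show ?thesis using assms(1,6) by (auto simp: outputs_U)
  qed
  then show ?thesis using assms by (auto simp: outputs_U tg_hom_def)
qed

lemma tg_hom_interface:
  assumes "tg_hom f G H" "fst f ` S \<subseteq> S'" "S \<subseteq> verts (und G)"
  shows "tg_hom f (interface G S) (interface H S')"
  using assms by (auto simp: tg_hom_def interface_def bang_verts_def)

lemma agree_interface:
  "agree G f g \<Longrightarrow> S \<subseteq> verts (und G) \<Longrightarrow> agree (interface G S) f g"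
  by (auto simp: agree_def interface_def bang_verts_def)

text \<open>Both maps of an isomorphism preserve inputs and outputs, so they restrict to mutually
  inverse maps of the interfaces. This allows an arbitrary copy to be exchanged for
  \<open>copy_graph\<close>.\<close>

lemma interface_iso:
  assumes "G \<cong>\<^sub>t H" "wf_digraph (und G)" "wf_digraph (und H)"
  shows "interface G (inputs (U G)) \<cong>\<^sub>t interface H (inputs (U H))"
    and "interface G (outputs (U G)) \<cong>\<^sub>t interface H (outputs (U H))"
    and "interface G (boundary (U G)) \<cong>\<^sub>t interface H (boundary (U H))"
proof -
  obtain f g where fg: "tg_hom f G H" "tg_hom g H G" "agree G (g \<circ>\<^sub>g f) gid" "agree H (f \<circ>\<^sub>g g) gid"
    using assms(1) unfolding tg_iso_def by blast
  have *: "interface G S \<cong>\<^sub>t interface H S'"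
    if "S \<subseteq> verts (und G)" "S' \<subseteq> verts (und H)" "fst f ` S \<subseteq> S'" "fst g ` S' \<subseteq> S" for S S'
    unfolding tg_iso_def using fg that by (blast intro: tg_hom_interface agree_interface)
  have f: "fst f ` inputs (U G) \<subseteq> inputs (U H)" "fst f ` outputs (U G) \<subseteq> outputs (U H)"
    using iso_inputs[OF assms(2,3) fg(1-3)] iso_outputs[OF assms(2,3) fg(1-3)] by auto
  have g: "fst g ` inputs (U H) \<subseteq> inputs (U G)" "fst g ` outputs (U H) \<subseteq> outputs (U G)"
    using iso_inputs[OF assms(3,2) fg(2,1,4)] iso_outputs[OF assms(3,2) fg(2,1,4)] by auto
  show "interface G (inputs (U G)) \<cong>\<^sub>t interface H (inputs (U H))"
    "interface G (outputs (U G)) \<cong>\<^sub>t interface H (outputs (U H))"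
    "interface G (boundary (U G)) \<cong>\<^sub>t interface H (boundary (U H))"
    by (rule *; use f g boundary_verts[of G] boundary_verts[of H] in \<open>auto simp: boundary_def\<close>)+
qed

section \<open>Interfaces and copying\<close>

lemma inputs_U_copy_graph:
  assumes "wf_digraph (und G)" "wf_digraph (und (copy_graph D G))"
  shows "inputs (U (copy_graph D G)) = {p \<in> verts (und (copy_graph D G)). fst p \<in> inputs (U G)}"
    (is "?L = ?R")
proof (rule set_eqI, rule iffI)
  fix p assume p: "p \<in> ?L"
  then have pV: "p \<in> verts (und (copy_graph D G))"
    by (simp add: inputs_U[OF assms(2)])
  have "vtype G (tail (und G) e) = Bang" if "e \<in> arcs (und G)" "head (und G) e = fst p" for e
  proof -
    \<comment> \<open>The lift of \<open>e\<close> that ends at \<open>p\<close>: if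
      \<open>p\<close> is tagged \<open>True\<close>, then the head of \<open>e\<close> lies in
      \<open>D\<close>, so the lift may carry that tag and its head inherits it.\<close>
    let ?e = "(e, snd p \<and> (tail (und G) e \<in> D \<or> head (und G) e \<in> D))"
    have "?e \<in> arcs (und (copy_graph D G))" "head (und (copy_graph D G)) ?e = p"
      using that pV by (auto simp: copy_graph_def prod_eq_iff)
    then have "vtype (copy_graph D G) (tail (und (copy_graph D G)) ?e) = Bang"
      using p unfolding inputs_U[OF assms(2)] by blast
    then show ?thesis by (simp add: copy_graph_def)
  qed
  then show "p \<in> ?R"
    using p unfolding inputs_U[OF assms(1)] inputs_U[OF assms(2)] by (auto simp: copy_graph_def)
next
  fix p assume "p \<in> ?R"
  then show "p \<in> ?L"
    unfolding inputs_U[OF assms(1)] inputs_U[OF assms(2)] by (auto simp: copy_graph_def)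
qed

lemma outputs_U_copy_graph:
  assumes "wf_digraph (und G)" "wf_digraph (und (copy_graph D G))"
  shows "outputs (U (copy_graph D G)) = {p \<in> verts (und (copy_graph D G)). fst p \<in> outputs (U G)}"
    (is "?L = ?R")
proof (rule set_eqI, rule iffI)
  fix p assume p: "p \<in> ?L"
  then have pV: "p \<in> verts (und (copy_graph D G))"
    by (simp add: outputs_U[OF assms(2)])
  have "vtype G (head (und G) e) = Bang" if "e \<in> arcs (und G)" "tail (und G) e = fst p" for e
  proof -
    let ?e = "(e, snd p \<and> (tail (und G) e \<in> D \<or> head (und G) e \<in> D))"
    have "?e \<in> arcs (und (copy_graph D G))" "tail (und (copy_graph D G)) ?e = p"
      using that pV by (auto simp: copy_graph_def prod_eq_iff)
    then have "vtype (copy_graph D G) (head (und (copy_graph D G)) ?e) = Bang"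
      using p unfolding outputs_U[OF assms(2)] by blast
    then show ?thesis by (simp add: copy_graph_def)
  qed
  then show "p \<in> ?R"
    using p unfolding outputs_U[OF assms(1)] outputs_U[OF assms(2)] by (auto simp: copy_graph_def)
next
  fix p assume "p \<in> ?R"
  then show "p \<in> ?L"
    unfolding outputs_U[OF assms(1)] outputs_U[OF assms(2)] by (auto simp: copy_graph_def)
qed

text \<open>An edge from the \<open>!\<close>-vertex \<open>b\<close> survives in the interface
  exactly when its head does.\<close>

lemma verts_B_interface:
  assumes "b \<in> bang_verts G"
  shows "verts (und (B (interface G S) b)) = verts (und (B G b)) \<inter> (bang_verts G \<union> S)"
  using assms by (auto simp: B_def full_sub_def arcs_ends_def arc_to_ends_def interface_def)

text \<open>The identity is an isomorphism: both sides have the same tagged vertices and edges. They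
  need not be equal as records, because their tail and head functions can differ on edges outside
  the interface.\<close>

lemma interface_copy_graph_iso:
  assumes "S \<subseteq> verts (und G)"
  shows "interface (copy_graph D G) {p \<in> verts (und (copy_graph D G)). fst p \<in> S}
    \<cong>\<^sub>t copy_graph (D \<inter> (bang_verts G \<union> S)) (interface G S)" (is "?L \<cong>\<^sub>t ?R")
proof -
  have "tg_hom gid ?L ?R" "tg_hom gid ?R ?L"
    using assms by (auto simp: tg_hom_def gid_def interface_def copy_graph_def bang_verts_def)
  then show ?thesis
    unfolding tg_iso_def by (intro exI[of _ gid]) (auto simp: agree_def gcomp_def gid_def)
qed

text \<open>The comparison runs from the interface of \<open>P\<close> to that of the explicit copy
  of \<open>G\<close>, then to the explicit copy of the interface, and finally to \<open>Q\<close>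
  by uniqueness of pushouts.\<close>

lemma interface_COPY_iso:
  assumes G: "typed_over (bang_typegraph T) G" and b: "b \<in> bang_verts G"
    and S: "S \<subseteq> verts (und G)" and S': "S' \<subseteq> verts (und P)"
    and PK: "typed_over (bang_typegraph T) P"
    and P: "interface P S' \<cong>\<^sub>t interface (copy_graph (verts (und (B G b))) G)
              {p \<in> verts (und (copy_graph (verts (und (B G b))) G)). fst p \<in> S}"
    and Q: "is_COPY T b (interface G S) Q"
  shows "interface P S' \<cong>\<^sub>t Q"
proof -
  let ?C = "copy_graph (verts (und (B G b)) \<inter> (bang_verts G \<union> S)) (interface G S)"
  have GS: "typed_over (bang_typegraph T) (interface G S)"
    using typed_over_interface[OF G S] .
  have wP: "wf_digraph (und (interface P S'))"
    using typed_over_wf[OF typed_over_interface[OF PK S']] .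
  have wC: "wf_digraph (und ?C)"
    using typed_over_wf[OF typed_over_copy_graph[OF GS]] .
  have wQ: "wf_digraph (und Q)"
    using typed_over_wf[OF is_COPY_typed_over[OF Q]] .
  have "interface P S' \<cong>\<^sub>t ?C"
    using tg_iso_trans[OF P interface_copy_graph_iso[OF S] wP wC] .
  moreover have "?C \<cong>\<^sub>t Q"
    using is_COPY_unique[OF is_COPY_copy_graph[OF GS] Q] by (simp add: verts_B_interface[OF b])
  ultimately show ?thesis
    using wP wQ by (rule tg_iso_trans)
qed

lemma interface_COPY:
  assumes G: "typed_over (bang_typegraph T) G" and b: "b \<in> bang_verts G" and P: "is_COPY T b G P"
  shows "is_COPY T b (interface G (inputs (U G))) Q \<Longrightarrow> interface P (inputs (U P)) \<cong>\<^sub>t Q"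
    and "is_COPY T b (interface G (outputs (U G))) Q \<Longrightarrow> interface P (outputs (U P)) \<cong>\<^sub>t Q"
    and "is_COPY T b (interface G (boundary (U G))) Q \<Longrightarrow> interface P (boundary (U P)) \<cong>\<^sub>t Q"
proof -
  define C where "C = copy_graph (verts (und (B G b))) G"
  have PK: "typed_over (bang_typegraph T) P"
    using is_COPY_typed_over[OF P] .
  have wf: "wf_digraph (und G)" "wf_digraph (und C)" "wf_digraph (und P)"
    unfolding C_def
    using typed_over_wf[OF G] typed_over_wf[OF typed_over_copy_graph[OF G]] typed_over_wf[OF PK] .
  have "P \<cong>\<^sub>t C"
    unfolding C_def by (rule is_COPY_unique[OF P is_COPY_copy_graph[OF G]])
  note iso = interface_iso[OF this wf(3,2)]
  have inp: "inputs (U C) = {p \<in> verts (und C). fst p \<in> inputs (U G)}"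
    and outp: "outputs (U C) = {p \<in> verts (und C). fst p \<in> outputs (U G)}"
    unfolding C_def
    by (rule inputs_U_copy_graph outputs_U_copy_graph; rule wf[unfolded C_def])+
  have bnd: "boundary (U C) = {p \<in> verts (und C). fst p \<in> boundary (U G)}"
    by (auto simp: boundary_def inp outp)
  note * = interface_COPY_iso[OF G b _ _ PK, folded C_def]
  show "is_COPY T b (interface G (inputs (U G))) Q \<Longrightarrow> interface P (inputs (U P)) \<cong>\<^sub>t Q"
    by (rule *[OF boundary_verts(1) boundary_verts(1) iso(1)[unfolded inp]])
  show "is_COPY T b (interface G (outputs (U G))) Q \<Longrightarrow> interface P (outputs (U P)) \<cong>\<^sub>t Q"
    by (rule *[OF boundary_verts(2) boundary_verts(2) iso(2)[unfolded outp]])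
  show "is_COPY T b (interface G (boundary (U G))) Q \<Longrightarrow> interface P (boundary (U P)) \<cong>\<^sub>t Q"
    by (rule *[OF boundary_verts(3) boundary_verts(3) iso(3)[unfolded bnd]])
qed

section \<open>Interfaces and deletion\<close>

lemma tg_iso_refl: "G \<cong>\<^sub>t G"
  unfolding tg_iso_def
  by (intro exI[of _ gid]) (auto simp: tg_hom_def agree_def gcomp_def gid_def)

text \<open>Both constructions leave the tail, head and typing functions untouched, so comparing
  vertex and edge sets gives an equality and not merely an isomorphism.\<close>

lemma interface_full_sub:
  assumes "V \<subseteq> verts (und G)"
  shows "interface (full_sub G V) (S \<inter> V) = full_sub (interface G S) ((bang_verts G \<union> S) \<inter> V)"
    (is "?L = ?R")
proof -
  have "verts (und ?L) = verts (und ?R)" "arcs (und ?L) = arcs (und ?R)"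
    using assms by (auto simp: interface_def full_sub_def bang_verts_def)
  then show ?thesis
    by (simp add: interface_def full_sub_def induce_subgraph_def)
qed

lemma interface_KILL:
  assumes "b \<in> bang_verts G" "S \<subseteq> verts (und G)"
  shows "interface (KILL b G) (S - verts (und (B G b))) = KILL b (interface G S)"
proof -
  let ?V = "verts (und G) - verts (und (B G b))"
  have "S - verts (und (B G b)) = S \<inter> ?V"
    using assms(2) by auto
  moreover have "(bang_verts G \<union> S) \<inter> ?V
      = verts (und (interface G S)) - verts (und (B (interface G S) b))"
    unfolding verts_B_interface[OF assms(1)] using assms(2)
    by (auto simp: interface_def bang_verts_def)
  ultimately show ?thesis
    using interface_full_sub[of ?V G S] by (simp add: KILL_def graph_minus_def)
qed

lemma interface_DROP:
  assumes "S \<subseteq> verts (und G)" "b \<notin> S"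
  shows "interface (DROP b G) S = DROP b (interface G S)"
proof -
  let ?V = "verts (und G) - {b}"
  have "S = S \<inter> ?V"
    using assms by auto
  moreover have "(bang_verts G \<union> S) \<inter> ?V = verts (und (interface G S)) - {b}"
    using assms by (auto simp: interface_def bang_verts_def)
  moreover have "verts (und (full_sub H {b})) = {b}" for H :: "('a, 'b, 'c, 'd) typed_graph"
    by (simp add: full_sub_def)
  ultimately show ?thesis
    using interface_full_sub[of ?V G S] by (simp add: DROP_def graph_minus_def)
qed

section \<open>The boundary after deletion\<close>

lemma U_DROP:
  assumes "b \<in> bang_verts G"
  shows "U (DROP b G) = U G"
proof -
  have "verts (und (U (DROP b G))) = verts (und (U G))" "arcs (und (U (DROP b G))) = arcs (und (U G))"
    using assms by (auto simp: U_def DROP_def graph_minus_def full_sub_def bang_verts_def)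
  then show ?thesis
    by (simp add: U_def DROP_def graph_minus_def full_sub_def induce_subgraph_def)
qed

text \<open>The edge joins two vertices of \<open>U G\<close>, where the open subgraph
  \<open>U (B G b)\<close> has no vertex adjacent to a wire-vertex outside it. The first conclusion
  serves inputs, the second outputs.\<close>

lemma open_B_no_crossing:
  assumes "bang_graph T G" "b \<in> bang_verts G" "e \<in> arcs (und G)"
    and "vtype G (tail (und G) e) \<noteq> Bang" "vtype G (head (und G) e) \<noteq> Bang"
  defines "D \<equiv> verts (und (B G b))"
  shows "\<exists>X. vtype G (head (und G) e) = Wire X \<Longrightarrow> head (und G) e \<notin> D \<Longrightarrow> tail (und G) e \<notin> D"
    and "\<exists>X. vtype G (tail (und G) e) = Wire X \<Longrightarrow> tail (und G) e \<notin> D \<Longrightarrow> head (und G) e \<notin> D"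
proof -
  have wf: "wf_digraph (und G)"
    using assms(1) by (auto simp: bang_graph_def dest: typed_over_wf)
  have op: "\<And>u w. u \<in> verts (und (U (B G b))) \<Longrightarrow> w \<in> wire_verts (U G) - verts (und (U (B G b))) \<Longrightarrow>
      (u, w) \<notin> arcs_ends (und (U G)) \<and> (w, u) \<notin> arcs_ends (und (U G))"
    using assms(1,2) unfolding bang_graph_def open_subgraph_def by blast
  have V: "verts (und (U (B G b))) = {v \<in> D. vtype G v \<noteq> Bang}"
    by (auto simp: D_def U_def full_sub_def bang_verts_def B_def)
  have W: "wire_verts (U G) = {v \<in> verts (und G). \<exists>X. vtype G v = Wire X}"
    by (auto simp: wire_verts_def U_def full_sub_def bang_verts_def)
  have E: "(tail (und G) e, head (und G) e) \<in> arcs_ends (und (U G))"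
    using assms(3-5) wf
    by (auto simp: arcs_ends_def arc_to_ends_def U_def full_sub_def bang_verts_def wf_digraph_def
        intro!: image_eqI[of _ _ e])
  have ends: "tail (und G) e \<in> verts (und G)" "head (und G) e \<in> verts (und G)"
    using wf assms(3) by (auto simp: wf_digraph_def)
  show "\<exists>X. vtype G (head (und G) e) = Wire X \<Longrightarrow> head (und G) e \<notin> D \<Longrightarrow> tail (und G) e \<notin> D"
    using op[of "tail (und G) e" "head (und G) e"] E ends assms(4,5) unfolding V W by auto
  show "\<exists>X. vtype G (tail (und G) e) = Wire X \<Longrightarrow> tail (und G) e \<notin> D \<Longrightarrow> head (und G) e \<notin> D"
    using op[of "head (und G) e" "tail (und G) e"] E ends assms(4,5) unfolding V W by auto
qed

text \<open>Deleting edges cannot destroy a surviving input or output. A new one could arise only if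
  a wire-vertex outside \<open>D\<close> lost an edge joining it to a non-\<open>!\<close> vertex of
  \<open>D\<close>, which openness rules out.\<close>

lemma boundary_U_KILL:
  assumes "bang_graph T G" "b \<in> bang_verts G"
  shows "inputs (U (KILL b G)) = inputs (U G) - verts (und (B G b))"
    and "outputs (U (KILL b G)) = outputs (U G) - verts (und (B G b))"
    and "boundary (U (KILL b G)) = boundary (U G) - verts (und (B G b))"
proof -
  define D where "D = verts (und (B G b))"
  have G: "typed_over (bang_typegraph T) G"
    using assms(1) by (simp add: bang_graph_def)
  have wfK: "wf_digraph (und (KILL b G))"
    unfolding KILL_def graph_minus_def
    by (rule typed_over_wf, rule typed_over_full_sub[OF G]) auto
  have K: "verts (und (KILL b G)) = verts (und G) - D"
      "arcs (und (KILL b G)) = {e \<in> arcs (und G). tail (und G) e \<notin> D \<and> head (und G) e \<notin> D}"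
      "tail (und (KILL b G)) = tail (und G)" "head (und (KILL b G)) = head (und G)"
      "vtype (KILL b G) = vtype G"
    using typed_over_wf[OF G]
    by (auto simp: KILL_def D_def graph_minus_def full_sub_def wf_digraph_def)
  note cross = open_B_no_crossing[OF assms, folded D_def]
  show i: "inputs (U (KILL b G)) = inputs (U G) - verts (und (B G b))"
    unfolding inputs_U[OF wfK] inputs_U[OF typed_over_wf[OF G]] K D_def[symmetric]
    using cross(1) by fastforce
  show o: "outputs (U (KILL b G)) = outputs (U G) - verts (und (B G b))"
    unfolding outputs_U[OF wfK] outputs_U[OF typed_over_wf[OF G]] K D_def[symmetric]
    using cross(2) by fastforce
  show "boundary (U (KILL b G)) = boundary (U G) - verts (und (B G b))"
    unfolding boundary_def i o by auto
qed

theorem theorem4p18: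
  fixes T :: "('o, 'm) signature"
    and G :: "('v, 'e, 'o, 'm) typed_graph"
    and b :: 'v
  assumes "compressed_signature T"
    and "bang_graph T G"
    and "b \<in> bang_verts G"
  shows
    "(\<forall>(P :: ('w, 'd, 'o, 'm) typed_graph) (Q :: ('x, 'c, 'o, 'm) typed_graph).
        is_COPY T b G P \<and> is_COPY T b (Bound_bang G) Q \<longrightarrow> Bound_bang P \<cong>\<^sub>t Q)
     \<and> Bound_bang (KILL b G) \<cong>\<^sub>t KILL b (Bound_bang G)
     \<and> Bound_bang (DROP b G) \<cong>\<^sub>t DROP b (Bound_bang G)
     \<and> (\<forall>(P :: ('w, 'd, 'o, 'm) typed_graph) (Q :: ('x, 'c, 'o, 'm) typed_graph).
        is_COPY T b G P \<and> is_COPY T b (In_bang G) Q \<longrightarrow> In_bang P \<cong>\<^sub>t Q)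
     \<and> In_bang (KILL b G) \<cong>\<^sub>t KILL b (In_bang G)
     \<and> In_bang (DROP b G) \<cong>\<^sub>t DROP b (In_bang G)
     \<and> (\<forall>(P :: ('w, 'd, 'o, 'm) typed_graph) (Q :: ('x, 'c, 'o, 'm) typed_graph).
        is_COPY T b G P \<and> is_COPY T b (Out_bang G) Q \<longrightarrow> Out_bang P \<cong>\<^sub>t Q)
     \<and> Out_bang (KILL b G) \<cong>\<^sub>t KILL b (Out_bang G)
     \<and> Out_bang (DROP b G) \<cong>\<^sub>t DROP b (Out_bang G)"
proof -
  have G: "typed_over (bang_typegraph T) G"
    using assms(2) by (simp add: bang_graph_def)
  have KG: "typed_over (bang_typegraph T) (KILL b G)" and DG: "typed_over (bang_typegraph T) (DROP b G)"
    unfolding KILL_def DROP_def graph_minus_def by (auto intro: typed_over_full_sub[OF G])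
  note eqs = Bound_bang_eq_interface In_bang_eq_interface Out_bang_eq_interface
  have kill: "Bound_bang (KILL b G) = KILL b (Bound_bang G)"
    "In_bang (KILL b G) = KILL b (In_bang G)" "Out_bang (KILL b G) = KILL b (Out_bang G)"
    using assms(2,3) boundary_verts[of G]
    by (simp_all add: eqs(1) eqs(2,3)[OF G] eqs(2,3)[OF KG] boundary_U_KILL interface_KILL)
  have "b \<notin> inputs (U G)" "b \<notin> outputs (U G)" "b \<notin> boundary (U G)"
    using assms(3) boundary_not_bang[of G] by auto
  then have drop: "Bound_bang (DROP b G) = DROP b (Bound_bang G)"
    "In_bang (DROP b G) = DROP b (In_bang G)" "Out_bang (DROP b G) = DROP b (Out_bang G)"
    using assms(3) boundary_verts[of G]
    by (simp_all add: eqs(1) eqs(2,3)[OF G] eqs(2,3)[OF DG] U_DROP interface_DROP)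
  \<comment> \<open>Rewriting the interfaces of \<open>P\<close> needs \<open>P\<close> to be typed
    over the typegraph, which is part of being a copy.\<close>
  have copy: "is_COPY T b (Bound_bang G) Q \<Longrightarrow> Bound_bang P \<cong>\<^sub>t Q"
    "is_COPY T b (In_bang G) Q \<Longrightarrow> In_bang P \<cong>\<^sub>t Q" "is_COPY T b (Out_bang G) Q \<Longrightarrow> Out_bang P \<cong>\<^sub>t Q"
    if "is_COPY T b G P" for P :: "('w, 'd, 'o, 'm) typed_graph" and Q :: "('x, 'c, 'o, 'm) typed_graph"
    using interface_COPY[OF G assms(3) that]
    by (simp_all add: eqs(1) eqs(2,3)[OF G] eqs(2,3)[OF is_COPY_typed_over[OF that]])
  show ?thesis
    \<comment> \<open>For killing and dropping the two sides are equal, so reflexivity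
      suffices.\<close>
    using copy by (simp add: kill drop tg_iso_refl)
qed

end
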